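(* Let $G$ be a connected $d$-degenerate graph and let $k$ be a prime number with $k > d \ge 2$. Suppose that one of the following holds: (i) $G$ is non-bipartite; (ii) $G$ is bipartite and there are two non-adjacent vertices $u, v$ of $G$ with $d(u)+d(v) < k$. Then $G$ has a non-singular index function $\eta$ with $\eta(v)=0$ for every $v\in V(G)$ and $\eta(e)\le k-1$ for every $e \in E(G)$.
   Context: Graphs are finite and simple; $d(v)$ denotes the degree of $v$ and $E(v)$ the set of edges incident to $v$. A graph is $d$-degenerate if every subgraph has a vertex of degree at most $d$. Fix an orientation $D$ of $G$ and introduce a variable $x_z$ for every $z\in V(G)\cup E(G)$. Let $$P_G=\prod_{(u,v)\in E(D)}\Big(\big(\textstyle\sum_{e\in E(u)}x_e+x_u\big)-\big(\sum_{e\in E(v)}x_e+x_v\big)\Big).$$ An index function of $G$ is a map $\eta: V(G)\cup E(G)\to\{0,1,2,\dots\}$; it is valid if $\sum_{z}\eta(z)=|E(G)|$. For a valid $\eta$, $c_\eta$ denotes the coefficient of the monomial $\prod_{z}x_z^{\eta(z)}$ in the expansion of $P_G$. An index function $\eta$ is non-singular if there is a valid index function $\eta'$ with $\eta'(z)\le\eta(z)$ for all $z$ and $c_{\eta'}\neq 0$. (This notion does not depend on the choice of orientation $D$.) *)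

theory Defs
  imports
    "HOL-Library.Poly_Mapping"
    "HOL-Computational_Algebra.Primes"
begin

section \<open>Finite simple graphs\<close>

text \<open>A graph is given by its vertex set and its set of edges, an edge being the
  two-element set of its ends.\<close>

locale simple_graph =
  fixes V :: "'a set" and E :: "'a set set"
  assumes finite_vertices: "finite V"
    and edge_ends: "e \<in> E \<Longrightarrow> e \<subseteq> V \<and> card e = 2"

definition incident_edges :: "'a set set \<Rightarrow> 'a \<Rightarrow> 'a set set" where
  "incident_edges E v = {e \<in> E. v \<in> e}"

definition graph_degree :: "'a set set \<Rightarrow> 'a \<Rightarrow> nat" where
  "graph_degree E v = card (incident_edges E v)"

definition subgraph_of :: "'a set \<Rightarrow> 'a set set \<Rightarrow> 'a set \<Rightarrow> 'a set set \<Rightarrow> bool" where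
  "subgraph_of W F V E \<longleftrightarrow> simple_graph W F \<and> W \<subseteq> V \<and> F \<subseteq> E"

text \<open>The graph without vertices has no vertex at all, so it is not counted among the
  subgraphs here.\<close>

definition degenerate :: "nat \<Rightarrow> 'a set \<Rightarrow> 'a set set \<Rightarrow> bool" where
  "degenerate d V E \<longleftrightarrow>
    (\<forall>W F. subgraph_of W F V E \<and> W \<noteq> {} \<longrightarrow> (\<exists>v\<in>W. graph_degree F v \<le> d))"

definition connected_graph :: "'a set \<Rightarrow> 'a set set \<Rightarrow> bool" where
  "connected_graph V E \<longleftrightarrow>
    V \<noteq> {} \<and> (\<forall>u\<in>V. \<forall>v\<in>V. (u, v) \<in> {(x, y). {x, y} \<in> E}\<^sup>*)"

definition bipartite :: "'a set \<Rightarrow> 'a set set \<Rightarrow> bool" where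
  "bipartite V E \<longleftrightarrow>
    (\<exists>X Y. X \<union> Y = V \<and> X \<inter> Y = {} \<and> (\<forall>e\<in>E. \<exists>x\<in>X. \<exists>y\<in>Y. e = {x, y}))"

definition orientation :: "'a set set \<Rightarrow> ('a \<times> 'a) set \<Rightarrow> bool" where
  "orientation E D \<longleftrightarrow>
    (\<forall>(u, v)\<in>D. {u, v} \<in> E) \<and> (\<forall>e\<in>E. \<exists>!p. p \<in> D \<and> e = {fst p, snd p})"


section \<open>The polynomial of a graph and its index functions\<close>

text \<open>Vertices and edges are put side by side in the sum type \<open>'a + 'a set\<close>.
  A monomial is a finitely supported exponent function, and a polynomial with integer
  coefficients is a finitely supported function on monomials; the ring structure is the
  convolution product of \<open>Poly_Mapping\<close>.\<close>

type_synonym 'a element = "'a + 'a set"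
type_synonym 'v mpolynomial = "('v \<Rightarrow>\<^sub>0 nat) \<Rightarrow>\<^sub>0 int"

definition elements :: "'a set \<Rightarrow> 'a set set \<Rightarrow> 'a element set" where
  "elements V E = Inl ` V \<union> Inr ` E"

definition var :: "'v \<Rightarrow> 'v mpolynomial" where
  "var z = Poly_Mapping.single (Poly_Mapping.single z 1) 1"

definition vertex_form :: "'a set set \<Rightarrow> 'a \<Rightarrow> 'a element mpolynomial" where
  "vertex_form E v = (\<Sum>e\<in>incident_edges E v. var (Inr e)) + var (Inl v)"

definition graph_poly :: "'a set set \<Rightarrow> ('a \<times> 'a) set \<Rightarrow> 'a element mpolynomial" where
  "graph_poly E D = (\<Prod>(u, v)\<in>D. vertex_form E u - vertex_form E v)"

text \<open>An index function is a function on all of \<open>'a element\<close> of which only the values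
  on \<open>elements V E\<close> are ever used.\<close>

definition valid_index :: "'a set \<Rightarrow> 'a set set \<Rightarrow> ('a element \<Rightarrow> nat) \<Rightarrow> bool" where
  "valid_index V E \<eta> \<longleftrightarrow> (\<Sum>z\<in>elements V E. \<eta> z) = card E"

definition index_exponent :: "'a set \<Rightarrow> 'a set set \<Rightarrow> ('a element \<Rightarrow> nat) \<Rightarrow> 'a element \<Rightarrow>\<^sub>0 nat" where
  "index_exponent V E \<eta> = (\<Sum>z\<in>elements V E. Poly_Mapping.single z (\<eta> z))"

lemma single_index_exponent:
  "Poly_Mapping.single (index_exponent V E \<eta>) 1 = (\<Prod>z\<in>elements V E. var z ^ \<eta> z)"
proof -
  have pow: "var z ^ n = Poly_Mapping.single (Poly_Mapping.single z n) 1"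
    for z :: "'a element" and n
    by (induction n) (simp_all add: var_def mult_single flip: single_add)
  have "(\<Prod>z\<in>A. var z ^ \<eta> z) = Poly_Mapping.single (\<Sum>z\<in>A. Poly_Mapping.single z (\<eta> z)) 1"
    for A :: "'a element set"
    by (induction A rule: infinite_finite_induct) (simp_all add: pow mult_single)
  then show ?thesis
    by (simp add: index_exponent_def)
qed

definition index_coeff ::
  "'a set \<Rightarrow> 'a set set \<Rightarrow> ('a \<times> 'a) set \<Rightarrow> ('a element \<Rightarrow> nat) \<Rightarrow> int" where
  "index_coeff V E D \<eta> = Poly_Mapping.lookup (graph_poly E D) (index_exponent V E \<eta>)"

definition non_singular ::
  "'a set \<Rightarrow> 'a set set \<Rightarrow> ('a \<times> 'a) set \<Rightarrow> ('a element \<Rightarrow> nat) \<Rightarrow> bool" where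
  "non_singular V E D \<eta> \<longleftrightarrow>
    (\<exists>\<eta>'. valid_index V E \<eta>' \<and> (\<forall>z\<in>elements V E. \<eta>' z \<le> \<eta> z) \<and> index_coeff V E D \<eta>' \<noteq> 0)"

end

theory Submission
  imports Defs
begin

text \<open>Over the field with \<open>k\<close> elements, the ideal generated by the \<open>k\<close>-th powers of the variables
  contains the \<open>k\<close>-th power of every linear form. So if every monomial of the graph polynomial
  contained a vertex variable or the \<open>k\<close>-th power of an edge variable, then replacing the vertex
  variables by \<open>0\<close> and the edge variables by linear forms in new variables would always give an
  element of that ideal.

  Alternating weights along walks choose these linear forms. If the graph is non-bipartite, an odd
  closed walk turns the form of every vertex \<open>w\<close> into \<open>2 z\<^sub>w\<close>. If it is bipartite, the form of
  every \<open>w \<noteq> u\<close> becomes \<open>z\<^sub>w\<close> and that of \<open>u\<close> becomes a sum of all \<open>z\<^sub>w\<close>, \<open>w \<noteq> u\<close>, with signs.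
  Order the new variables lexicographically along a degeneracy order, in the bipartite case with
  \<open>z\<^sub>v\<close> in front. The leading monomial then has exponents at most \<open>d\<close>, except that \<open>z\<^sub>v\<close> gets the
  exponent \<open>d(u) + d(v)\<close>, and its coefficient is up to sign a power of \<open>2\<close>. As \<open>k\<close> is an odd
  prime, the result is not in the ideal.\<close>

abbreviation (input) lookup where "lookup \<equiv> Poly_Mapping.lookup"
abbreviation (input) keys where "keys \<equiv> Poly_Mapping.keys"
abbreviation (input) single where "single \<equiv> Poly_Mapping.single"

section \<open>Substitution into integer polynomials\<close>

definition subst_monom :: "('v \<Rightarrow> 'r::comm_ring_1) \<Rightarrow> ('v \<Rightarrow>\<^sub>0 nat) \<Rightarrow> 'r" where
  "subst_monom f m = (\<Prod>z\<in>keys m. f z ^ lookup m z)"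

definition subst :: "('v \<Rightarrow> 'r::comm_ring_1) \<Rightarrow> 'v mpolynomial \<Rightarrow> 'r" where
  "subst f p = (\<Sum>m\<in>keys p. of_int (lookup p m) * subst_monom f m)"

lemma subst_monom_superset:
  "finite A \<Longrightarrow> keys m \<subseteq> A \<Longrightarrow> subst_monom f m = (\<Prod>z\<in>A. f z ^ lookup m z)"
  unfolding subst_monom_def
  by (intro prod.mono_neutral_left) (auto simp: in_keys_iff)

lemma subst_superset:
  "finite A \<Longrightarrow> keys p \<subseteq> A \<Longrightarrow> subst f p = (\<Sum>m\<in>A. of_int (lookup p m) * subst_monom f m)"
  unfolding subst_def
  by (intro sum.mono_neutral_left) (auto simp: in_keys_iff)

lemma subst_monom_add: "subst_monom f (m + n) = subst_monom f m * subst_monom f n"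
proof -
  have "keys (m + n) \<subseteq> keys m \<union> keys n"
    by (rule keys_add)
  then show ?thesis
    by (simp add: subst_monom_superset[of "keys m \<union> keys n"] lookup_add power_add prod.distrib)
qed

lemma subst_single: "subst f (single m c) = of_int c * subst_monom f m"
  by (simp add: subst_def)

lemma subst_var [simp]: "subst f (var z) = f z"
  by (simp add: var_def subst_single subst_monom_def)

lemma subst_zero [simp]: "subst f 0 = 0"
  by (simp add: subst_def)

lemma subst_one [simp]: "subst f 1 = 1"
  by (simp add: subst_def subst_monom_def lookup_one)

lemma subst_add: "subst f (p + q) = subst f p + subst f q"
  using keys_add[of p q]
  by (simp add: subst_superset[of "keys p \<union> keys q"] lookup_add algebra_simps sum.distrib)

lemma subst_uminus: "subst f (- p) = - subst f p"
  using subst_add[of f p "- p"] by (simp add: eq_neg_iff_add_eq_0 add.commute)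

lemma subst_diff: "subst f (p - q) = subst f p - subst f q"
  using subst_add[of f p "- q"] by (simp add: subst_uminus)

lemma subst_sum: "subst f (\<Sum>i\<in>A. p i) = (\<Sum>i\<in>A. subst f (p i))"
  by (induction A rule: infinite_finite_induct) (simp_all add: subst_add)

lemma sum_singles:
  "finite A \<Longrightarrow> keys p \<subseteq> A \<Longrightarrow> (\<Sum>m\<in>A. single m (lookup p m)) = p"
  by (rule poly_mapping_eqI) (auto simp: lookup_sum lookup_single when_def in_keys_iff)

lemma subst_mult: "subst f (p * q) = subst f p * subst f q"
proof -
  have "p * q = (\<Sum>m\<in>keys p. single m (lookup p m)) * (\<Sum>n\<in>keys q. single n (lookup q n))"
    by (simp only: sum_singles finite_keys subset_refl)
  also have "\<dots> = (\<Sum>m\<in>keys p. \<Sum>n\<in>keys q. single (m + n) (lookup p m * lookup q n))"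
    by (simp add: sum_product mult_single)
  finally have "subst f (p * q) =
      (\<Sum>m\<in>keys p. \<Sum>n\<in>keys q. of_int (lookup p m * lookup q n) * subst_monom f (m + n))"
    by (simp only: subst_sum subst_single)
  then show ?thesis
    by (simp add: subst_monom_add subst_def sum_product mult_ac)
qed

lemma subst_prod: "subst f (\<Prod>i\<in>A. p i) = (\<Prod>i\<in>A. subst f (p i))"
  by (induction A rule: infinite_finite_induct) (simp_all add: subst_mult)


section \<open>The ideal generated by a prime and its powers of the variables\<close>

text \<open>Describes the ideal generated by \<open>k\<close> and the \<open>k\<close>-th powers of
  all variables through coefficients, so that a single coefficient suffices to refute
  membership.\<close>

definition frobenius_ideal :: "nat \<Rightarrow> 'v mpolynomial set" where
  "frobenius_ideal k = {p. \<forall>m. (\<forall>i. lookup m i < k) \<longrightarrow> int k dvd lookup p m}"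

lemma frobenius_ideal_zero [simp]: "0 \<in> frobenius_ideal k"
  by (simp add: frobenius_ideal_def)

lemma frobenius_ideal_add:
  "p \<in> frobenius_ideal k \<Longrightarrow> q \<in> frobenius_ideal k \<Longrightarrow> p + q \<in> frobenius_ideal k"
  by (simp add: frobenius_ideal_def lookup_add)

lemma frobenius_ideal_sum:
  "(\<And>i. i \<in> A \<Longrightarrow> p i \<in> frobenius_ideal k) \<Longrightarrow> (\<Sum>i\<in>A. p i) \<in> frobenius_ideal k"
  by (induction A rule: infinite_finite_induct) (simp_all add: frobenius_ideal_add)

text \<open>A divisor of a monomial with all exponents below \<open>k\<close> has this property too,
  so \<open>k\<close> divides every summand of the convolution.\<close>

lemma frobenius_ideal_mult:
  fixes p q :: "'v mpolynomial"
  assumes "p \<in> frobenius_ideal k"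
  shows "p * q \<in> frobenius_ideal k"
  unfolding frobenius_ideal_def
proof (intro CollectI allI impI)
  fix m :: "'v \<Rightarrow>\<^sub>0 nat" assume m: "\<forall>i. lookup m i < k"
  have "int k dvd lookup p l * (\<Sum>n. lookup q n when m = l + n)" for l
  proof (cases "\<exists>n. m = l + n")
    case True
    then obtain n where "m = l + n" by blast
    then have "lookup l i \<le> lookup m i" for i
      by (simp add: lookup_add)
    then have "\<forall>i. lookup l i < k"
      using m le_less_trans by blast
    then show ?thesis
      using assms by (simp add: frobenius_ideal_def)
  qed simp
  then show "int k dvd lookup (p * q) m"
    unfolding lookup_mult Sum_any.expand_set by (intro dvd_sum)
qed

lemma frobenius_ideal_mult_left:
  "q \<in> frobenius_ideal k \<Longrightarrow> p * q \<in> frobenius_ideal k"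
  by (simp add: frobenius_ideal_mult mult.commute[of p])

lemma of_nat_in_frobenius_ideal: "k dvd n \<Longrightarrow> of_nat n \<in> frobenius_ideal k"
  by (auto simp: frobenius_ideal_def lookup_of_nat when_def)

text \<open>Binomial theorem: the prime \<open>k\<close> divides all inner binomial coefficients,
  and the two outer terms are the assumed powers.\<close>

lemma frobenius_ideal_power_add:
  assumes "prime k" "p ^ k \<in> frobenius_ideal k" "q ^ k \<in> frobenius_ideal k"
  shows "(p + q) ^ k \<in> frobenius_ideal k"
  unfolding binomial_ring
proof (rule frobenius_ideal_sum)
  fix i assume "i \<in> {..k}"
  then consider "i = 0" | "i = k" | "i < k" "i \<noteq> 0" by fastforce
  then show "of_nat (k choose i) * p ^ i * q ^ (k - i) \<in> frobenius_ideal k"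
  proof cases
    case 3
    then have "k dvd (k choose i)"
      using assms(1) by (intro dvd_choose_prime) auto
    then show ?thesis
      by (intro frobenius_ideal_mult of_nat_in_frobenius_ideal)
  qed (use assms in simp_all)
qed

lemma frobenius_ideal_power_sum:
  assumes "prime k" "\<And>i. i \<in> A \<Longrightarrow> p i ^ k \<in> frobenius_ideal k"
  shows "(\<Sum>i\<in>A. p i) ^ k \<in> frobenius_ideal k"
  using assms(2)
  by (induction A rule: infinite_finite_induct)
    (use assms(1) in \<open>simp_all add: frobenius_ideal_power_add prime_gt_0_nat zero_power\<close>)

lemma var_power_in_frobenius_ideal: "var z ^ k \<in> frobenius_ideal k"
proof -
  have "var z ^ n = single (single z n) 1" for n
    by (induction n) (simp_all add: var_def mult_single flip: single_add)
  then show ?thesis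
    by (auto simp: frobenius_ideal_def lookup_single when_def)
qed

lemma frobenius_ideal_power_linear:
  assumes "prime k"
  shows "(\<Sum>i\<in>A. of_int (c i) * var (z i)) ^ k \<in> frobenius_ideal k"
  using assms
  by (intro frobenius_ideal_power_sum)
    (simp_all add: power_mult_distrib frobenius_ideal_mult_left var_power_in_frobenius_ideal)

text \<open>Used in contrapositive form: if the image of \<open>p\<close> is outside the ideal, some
  monomial of \<open>p\<close> has all its substituted variable powers outside it.\<close>

lemma subst_in_frobenius_ideal:
  assumes "\<And>m. m \<in> keys p \<Longrightarrow> \<exists>z\<in>keys m. f z ^ lookup m z \<in> frobenius_ideal k"
  shows "subst f p \<in> frobenius_ideal k"
  unfolding subst_def
proof (intro frobenius_ideal_sum frobenius_ideal_mult_left)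
  fix m assume "m \<in> keys p"
  then obtain z where "z \<in> keys m" "f z ^ lookup m z \<in> frobenius_ideal k"
    using assms by blast
  then show "subst_monom f m \<in> frobenius_ideal k"
    unfolding subst_monom_def by (subst prod.remove[of _ z]) (auto intro: frobenius_ideal_mult)
qed


section \<open>Lexicographically leading monomials\<close>

text \<open>The order of \<open>Poly_Mapping\<close> compares exponents at the least variable where they differ,
  so smaller variables give larger monomials.\<close>

definition leading :: "'v::linorder mpolynomial \<Rightarrow> ('v \<Rightarrow>\<^sub>0 nat) \<Rightarrow> int \<Rightarrow> bool" where
  "leading p m c \<longleftrightarrow> (\<exists>r. p = single m c + r \<and> (\<forall>n\<in>keys r. n < m))"

lemma leading_lookup: "leading p m c \<Longrightarrow> lookup p m = c"
  by (auto simp: leading_def lookup_add in_keys_iff)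

lemma leading_one: "leading 1 0 1"
  unfolding leading_def by (rule exI[of _ 0]) simp

text \<open>The order on exponents is strictly monotone under addition, so a product of terms other
  than the two leading ones is strictly smaller.\<close>

lemma leading_mult:
  assumes "leading p m c" "leading q n d"
  shows "leading (p * q) (m + n) (c * d)"
proof -
  obtain r where r: "p = single m c + r" "\<And>l. l \<in> keys r \<Longrightarrow> l < m"
    using assms by (auto simp: leading_def)
  obtain s where s: "q = single n d + s" "\<And>l. l \<in> keys s \<Longrightarrow> l < n"
    using assms by (auto simp: leading_def)
  let ?t = "single m c * s + r * single n d + r * s"
  have "p * q = single (m + n) (c * d) + ?t"
    by (simp add: r(1) s(1) algebra_simps mult_single)
  moreover have "l < m + n" if l: "l \<in> keys ?t" for l
  proof -
    have "l \<in> keys (single m c * s) \<union> keys (r * single n d) \<union> keys (r * s)"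
      using l keys_add[of "single m c * s + r * single n d" "r * s"]
        keys_add[of "single m c * s" "r * single n d"] by blast
    then consider "l \<in> keys (single m c * s)" | "l \<in> keys (r * single n d)" | "l \<in> keys (r * s)"
      by blast
    then obtain a b where "l = a + b" "a \<le> m \<and> b < n \<or> a < m \<and> b \<le> n"
    proof cases
      case 1
      then obtain a b where "l = a + b" "a \<in> keys (single m c)" "b \<in> keys s"
        using keys_mult[of "single m c" s] by blast
      then show ?thesis
        using that[of a b] s(2) by (simp split: if_splits)
    next
      case 2
      then obtain a b where "l = a + b" "a \<in> keys r" "b \<in> keys (single n d)"
        using keys_mult[of r "single n d"] by blast
      then show ?thesis
        using that[of a b] r(2) by (simp split: if_splits)
    next
      case 3
      then obtain a b where "l = a + b" "a \<in> keys r" "b \<in> keys s"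
        using keys_mult[of r s] by blast
      then show ?thesis
        using that[of a b] r(2) s(2) by (simp add: less_imp_le)
    qed
    then show ?thesis
      using add_le_less_mono[of a m b n] add_less_le_mono[of a m b n] by blast
  qed
  ultimately show ?thesis
    unfolding leading_def by blast
qed

lemma leading_prod:
  "(\<And>i. i \<in> A \<Longrightarrow> leading (p i) (m i) (c i)) \<Longrightarrow> leading (\<Prod>i\<in>A. p i) (\<Sum>i\<in>A. m i) (\<Prod>i\<in>A. c i)"
  by (induction A rule: infinite_finite_induct) (simp_all add: leading_one leading_mult)

lemma leading_diff:
  assumes "leading p m c" "leading q n d" "n < m"
  shows "leading (p - q) m c"
proof -
  obtain r where r: "p = single m c + r" "\<And>l. l \<in> keys r \<Longrightarrow> l < m"
    using assms by (auto simp: leading_def)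
  obtain s where s: "q = single n d + s" "\<And>l. l \<in> keys s \<Longrightarrow> l < n"
    using assms by (auto simp: leading_def)
  have "l < m" if "l \<in> keys (r - (single n d + s))" for l
  proof -
    have "l \<in> keys r \<union> keys (single n d) \<union> keys s"
      using that keys_diff[of r "single n d + s"] keys_add[of "single n d" s] by blast
    then show ?thesis
      using r(2) s(2) assms(3) by (fastforce split: if_splits)
  qed
  then show ?thesis
    unfolding leading_def using r(1) s(1) by (intro exI[of _ "r - (single n d + s)"]) simp
qed

lemma leading_uminus: "leading p m c \<Longrightarrow> leading (- p) m (- c)"
proof -
  assume "leading p m c"
  then obtain r where "p = single m c + r" "\<forall>n\<in>keys r. n < m"
    by (auto simp: leading_def)
  then show ?thesis
    unfolding leading_def by (intro exI[of _ "- r"]) (simp add: single_uminus)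
qed

lemma single_less_single:
  fixes i j :: "'v::linorder"
  shows "i < j \<Longrightarrow> single j (1::nat) < single i 1"
  by transfer (auto simp: less_fun_def when_def intro!: exI[of _ i])

text \<open>Distinct variables cannot cancel, and the smaller one wins; its coefficient changes sign
  if it comes from the subtracted form.\<close>

lemma leading_diff_vars:
  fixes i j :: "'v::linorder"
  assumes "leading p (single i 1) c" "leading q (single j 1) d" "i \<noteq> j"
  shows "leading (p - q) (single (min i j) 1) (if i < j then c else - d)"
proof (cases "i < j")
  case True
  then show ?thesis
    using leading_diff[OF assms(1,2) single_less_single] by (simp add: min_absorb1)
next
  case False
  then have "j < i" using assms(3) by simp
  then have "leading (p - q) (single j 1) (- d)" "min i j = j"
    using leading_uminus[OF leading_diff[OF assms(2,1) single_less_single]] by simp_all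
  then show ?thesis
    using False by simp
qed

text \<open>The comparison is restricted to nonzero coefficients so that a form with a single
  nonzero term is covered whatever the order of the other variables.\<close>

lemma leading_linear:
  fixes q :: "'b \<Rightarrow> 'v::linorder"
  assumes "finite A" "i \<in> A" "\<And>j. j \<in> A \<Longrightarrow> j \<noteq> i \<Longrightarrow> c j \<noteq> 0 \<Longrightarrow> q i < q j"
  shows "leading (\<Sum>j\<in>A. of_int (c j) * var (q j)) (single (q i) 1) (c i)"
proof -
  have monom: "of_int a * var z = single (single z 1) a" for a and z :: 'v
    by (simp add: var_def mult_single flip: single_of_int)
  have "n < single (q i) 1" if "n \<in> keys (\<Sum>j\<in>A - {i}. of_int (c j) * var (q j))" for n
  proof -
    have "\<exists>j\<in>A - {i}. lookup (of_int (c j) * var (q j)) n \<noteq> 0"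
      using that unfolding in_keys_iff lookup_sum by (metis (mono_tags, lifting) sum.neutral)
    then obtain j where j: "j \<in> A - {i}" "n \<in> keys (of_int (c j) * var (q j))"
      by (auto simp: in_keys_iff)
    then have "c j \<noteq> 0" "n = single (q j) 1"
      by (auto simp: monom split: if_splits)
    then show ?thesis
      using assms(3) j single_less_single by blast
  qed
  then show ?thesis
    unfolding leading_def using assms(1,2)
    by (intro exI[of _ "\<Sum>j\<in>A - {i}. of_int (c j) * var (q j)"])
      (simp add: sum.remove[of A i] monom)
qed


section \<open>The graph polynomial\<close>

lemma keys_vertex_form:
  assumes "n \<in> keys (vertex_form E v)"
  shows "\<exists>z\<in>insert (Inl v) (Inr ` incident_edges E v). n = single z 1"
proof -
  have "n \<in> keys (\<Sum>e\<in>incident_edges E v. var (Inr e)) \<union> keys (var (Inl v))"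
    using assms keys_add[of "\<Sum>e\<in>incident_edges E v. var (Inr e)" "var (Inl v)"]
    unfolding vertex_form_def by blast
  then show ?thesis
  proof
    assume "n \<in> keys (\<Sum>e\<in>incident_edges E v. var (Inr e))"
    then have "\<exists>e\<in>incident_edges E v. lookup (var (Inr e)) n \<noteq> 0"
      unfolding in_keys_iff lookup_sum by (metis (mono_tags, lifting) sum.neutral)
    then show ?thesis
      by (auto simp: var_def lookup_single when_def split: if_splits)
  qed (simp add: var_def)
qed

text \<open>Each factor contributes exactly one variable of \<open>Z\<close> to a monomial. For the
  graph polynomial this makes every occurring exponent function a valid index function.\<close>

lemma keys_prod_linear:
  assumes "finite Z" "\<And>i n. i \<in> A \<Longrightarrow> n \<in> keys (p i) \<Longrightarrow> \<exists>z\<in>Z. n = single z 1"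
    and "m \<in> keys (\<Prod>i\<in>A. p i)"
  shows "keys m \<subseteq> Z \<and> (\<Sum>z\<in>Z. lookup m z) = card A"
  using assms(2,3)
proof (induction A arbitrary: m rule: infinite_finite_induct)
  case (insert i A)
  then obtain n l where m: "m = n + l" "n \<in> keys (p i)" "l \<in> keys (\<Prod>i\<in>A. p i)"
    using keys_mult[of "p i" "\<Prod>i\<in>A. p i"] by auto
  obtain z where z: "z \<in> Z" "n = single z 1"
    using insert.prems(1) m(2) by blast
  have l: "keys l \<subseteq> Z" "(\<Sum>z\<in>Z. lookup l z) = card A"
    using insert.IH[OF _ m(3)] insert.prems(1) by blast+
  have "keys m \<subseteq> Z"
    using keys_add[of n l] l(1) z by (auto simp: m(1) split: if_splits)
  moreover have "(\<Sum>y\<in>Z. lookup n y) = 1"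
    using z assms(1) by (simp add: lookup_single when_def)
  ultimately show ?case
    using insert.hyps l(2) by (simp add: m(1) lookup_add sum.distrib)
qed simp_all

lemma simple_graph_finite_edges: "simple_graph V E \<Longrightarrow> finite E"
  by (rule finite_subset[of _ "Pow V"])
    (auto dest: simple_graph.edge_ends simp: simple_graph.finite_vertices)

text \<open>Turns the unique existence in \<open>orientation\<close> into a bijection, so that
  factors of the graph polynomial can be counted by edges.\<close>

lemma orientation_bij_betw:
  assumes "orientation E D"
  shows "bij_betw (\<lambda>(u, v). {u, v}) D E"
proof -
  have in_E: "{fst p, snd p} \<in> E" if "p \<in> D" for p
    using assms that unfolding orientation_def by fastforce
  have ex1: "\<exists>!p. p \<in> D \<and> e = {fst p, snd p}" if "e \<in> E" for e
    using conjunct2[OF assms[unfolded orientation_def]] that by (rule bspec)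
  have "inj_on (\<lambda>p. {fst p, snd p}) D"
  proof (rule inj_onI)
    fix p p' assume p: "p \<in> D" "p' \<in> D" and eq: "{fst p, snd p} = {fst p', snd p'}"
    have "\<exists>\<^sub>\<le>\<^sub>1r. r \<in> D \<and> {fst p, snd p} = {fst r, snd r}"
      using ex1[OF in_E[OF p(1)]] unfolding ex1_iff_ex_Uniq by (rule conjunct2)
    then show "p = p'"
      by (rule Uniq_D) (rule conjI p eq refl)+
  qed
  moreover have "(\<lambda>p. {fst p, snd p}) ` D = E"
  proof
    show "(\<lambda>p. {fst p, snd p}) ` D \<subseteq> E"
      using in_E by blast
    show "E \<subseteq> (\<lambda>p. {fst p, snd p}) ` D"
    proof
      fix e assume "e \<in> E"
      then obtain p where "p \<in> D" "e = {fst p, snd p}"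
        using ex1_implies_ex[OF ex1] by blast
      then show "e \<in> (\<lambda>p. {fst p, snd p}) ` D"
        by (intro image_eqI)
    qed
  qed
  ultimately show ?thesis
    by (simp add: bij_betw_def case_prod_unfold)
qed

lemma keys_graph_poly:
  assumes "simple_graph V E" "orientation E D" "m \<in> keys (graph_poly E D)"
  shows "keys m \<subseteq> elements V E" "(\<Sum>z\<in>elements V E. lookup m z) = card E"
proof -
  have "finite (elements V E)"
    using assms(1) by (simp add: elements_def simple_graph_finite_edges simple_graph.finite_vertices)
  moreover have "\<exists>z\<in>elements V E. n = single z 1"
    if p: "p \<in> D" and n: "n \<in> keys (case p of (u, v) \<Rightarrow> vertex_form E u - vertex_form E v)" for p n
  proof -
    obtain u v where uv: "p = (u, v)" by (cases p)
    then have "{u, v} \<in> E"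
      using p assms(2) by (auto simp: orientation_def)
    then have "u \<in> V" "v \<in> V"
      using simple_graph.edge_ends[OF assms(1)] by blast+
    moreover have "n \<in> keys (vertex_form E u) \<union> keys (vertex_form E v)"
      using n keys_diff[of "vertex_form E u" "vertex_form E v"] by (auto simp: uv)
    ultimately show ?thesis
      by (fastforce dest: keys_vertex_form simp: elements_def incident_edges_def)
  qed
  ultimately have "keys m \<subseteq> elements V E \<and> (\<Sum>z\<in>elements V E. lookup m z) = card D"
    using assms(3) unfolding graph_poly_def by (intro keys_prod_linear) auto
  moreover have "card D = card E"
    using orientation_bij_betw[OF assms(2)] by (rule bij_betw_same_card)
  ultimately show "keys m \<subseteq> elements V E" "(\<Sum>z\<in>elements V E. lookup m z) = card E"
    by simp_all
qed

section \<open>Substituting linear forms and reading off an index function\<close>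

lemma subst_vertex_form:
  "subst (case_sum (\<lambda>_. 0) x) (vertex_form E v) = (\<Sum>e\<in>incident_edges E v. x e)"
  by (simp add: vertex_form_def subst_add subst_sum)

text \<open>The factor of an arc has the variable of its \<open>q\<close>-smaller end as leading
  monomial. Hence the exponent of \<open>i\<close> in the leading monomial of the product counts the
  edges with least \<open>q\<close>-value \<open>i\<close>, and by \<open>few\<close> it is below
  \<open>k\<close>. The leading coefficient is a product of values of \<open>c\<close> up to sign,
  not divisible by the prime \<open>k\<close>.\<close>

lemma subst_graph_poly_notin_frobenius_ideal:
  fixes x :: "'a set \<Rightarrow> 'v::linorder mpolynomial" and q :: "'a \<Rightarrow> 'v"
  assumes "simple_graph V E" "orientation E D" "prime k"
    and lead: "\<And>w. w \<in> V \<Longrightarrow> leading (\<Sum>e\<in>incident_edges E w. x e) (single (q w) 1) (c w)"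
    and c: "\<And>w. w \<in> V \<Longrightarrow> \<not> int k dvd c w"
    and q: "\<And>v w. {v, w} \<in> E \<Longrightarrow> q v \<noteq> q w"
    and few: "\<And>i. card {e \<in> E. Min (q ` e) = i} < k"
  shows "subst (case_sum (\<lambda>_. 0) x) (graph_poly E D) \<notin> frobenius_ideal k"
proof -
  let ?Y = "\<lambda>w. \<Sum>e\<in>incident_edges E w. x e"
  define m where "m = (\<Sum>(u, v)\<in>D. single (min (q u) (q v)) (1::nat))"
  define C where "C = (\<Prod>(u, v)\<in>D. if q u < q v then c u else - c v)"
  have bij: "bij_betw (\<lambda>(u, v). {u, v}) D E"
    using orientation_bij_betw[OF assms(2)] .
  have fin: "finite E" "finite D"
    using simple_graph_finite_edges[OF assms(1)] bij by (simp_all add: bij_betw_finite)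
  have D: "u \<in> V" "v \<in> V" "{u, v} \<in> E" if "(u, v) \<in> D" for u v
    using that assms(2) simple_graph.edge_ends[OF assms(1), of "{u, v}"]
    by (auto simp: orientation_def)
  have "subst (case_sum (\<lambda>_. 0) x) (graph_poly E D) = (\<Prod>(u, v)\<in>D. ?Y u - ?Y v)"
    by (simp add: graph_poly_def subst_prod split_beta subst_diff subst_vertex_form)
  moreover have "leading (\<Prod>(u, v)\<in>D. ?Y u - ?Y v) m C"
    unfolding m_def C_def
  proof (rule leading_prod, clarify)
    fix u v assume "(u, v) \<in> D"
    then show "leading (?Y u - ?Y v) (single (min (q u) (q v)) 1) (if q u < q v then c u else - c v)"
      by (intro leading_diff_vars lead q) (auto dest: D)
  qed
  ultimately have "lookup (subst (case_sum (\<lambda>_. 0) x) (graph_poly E D)) m = C"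
    by (simp add: leading_lookup)
  moreover have "\<not> int k dvd C"
    using fin(2) c assms(3) D by (auto simp: C_def prime_dvd_prod_iff split: if_splits)
  moreover have "lookup m i < k" for i
  proof -
    have "lookup m i = card {p \<in> D. min (q (fst p)) (q (snd p)) = i}"
      unfolding m_def lookup_sum
      by (simp add: split_beta lookup_single when_def fin(2) flip: sum.inter_filter)
    also have "\<dots> = card ((\<lambda>(u, v). {u, v}) ` {p \<in> D. min (q (fst p)) (q (snd p)) = i})"
      by (rule card_image[symmetric], rule inj_on_subset[OF bij_betw_imp_inj_on[OF bij]]) auto
    also have "\<dots> \<le> card {e \<in> E. Min (q ` e) = i}"
      using fin(1) D by (intro card_mono) auto
    also have "\<dots> < k"
      by (rule few)
    finally show ?thesis .
  qed
  ultimately show ?thesis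
    by (auto simp: frobenius_ideal_def)
qed

lemma non_singular_edge_index:
  fixes x :: "'a set \<Rightarrow> 'v mpolynomial"
  assumes "simple_graph V E" "orientation E D" "prime k"
    and x: "\<And>e. e \<in> E \<Longrightarrow> x e ^ k \<in> frobenius_ideal k"
    and notin: "subst (case_sum (\<lambda>_. 0) x) (graph_poly E D) \<notin> frobenius_ideal k"
  shows "\<exists>\<eta>. non_singular V E D \<eta> \<and> (\<forall>v\<in>V. \<eta> (Inl v) = 0) \<and> (\<forall>e\<in>E. \<eta> (Inr e) \<le> k - 1)"
proof -
  obtain m where m: "m \<in> keys (graph_poly E D)"
    and keys_m: "\<And>z. z \<in> keys m \<Longrightarrow> case_sum (\<lambda>_. 0) x z ^ lookup m z \<notin> frobenius_ideal k"
    using notin subst_in_frobenius_ideal[of "graph_poly E D" "case_sum (\<lambda>_. 0) x" k] by auto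
  note supp = keys_graph_poly[OF assms(1,2) m]
  have "finite (elements V E)"
    using assms(1) by (simp add: elements_def simple_graph_finite_edges simple_graph.finite_vertices)
  then have "index_exponent V E (lookup m) = m"
    unfolding index_exponent_def using supp(1) by (rule sum_singles)
  \<comment> \<open>The exponents of the surviving monomial serve both as the index function and as
    the valid one below it.\<close>
  then have "non_singular V E D (lookup m)"
    unfolding non_singular_def valid_index_def index_coeff_def
    using m supp(2) by (intro exI[of _ "lookup m"]) (simp add: in_keys_iff)
  \<comment> \<open>A vertex variable is replaced by 0, so a positive power of it would fall into
    the ideal.\<close>
  moreover have "lookup m (Inl v) = 0" for v
    using keys_m[of "Inl v"] by (cases "lookup m (Inl v)") (auto simp: in_keys_iff)
  moreover have "lookup m (Inr e) < k" if "e \<in> E" for e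
  proof (rule ccontr)
    assume "\<not> lookup m (Inr e) < k"
    then have "k \<le> lookup m (Inr e)" by simp
    then have "x e ^ lookup m (Inr e) = x e ^ k * x e ^ (lookup m (Inr e) - k)"
      by (simp flip: power_add)
    then have "x e ^ lookup m (Inr e) \<in> frobenius_ideal k"
      using x[OF that] frobenius_ideal_mult by metis
    moreover have "Inr e \<in> keys m"
      using \<open>k \<le> lookup m (Inr e)\<close> prime_gt_0_nat[OF assms(3)] by (simp add: in_keys_iff)
    ultimately show False
      using keys_m by fastforce
  qed
  ultimately show ?thesis
    by (intro exI[of _ "lookup m"]) fastforce
qed

lemma sum_incident_linear_forms:
  fixes a :: "'a \<Rightarrow> 'a set \<Rightarrow> int"
  shows "(\<Sum>e\<in>incident_edges E w. \<Sum>v\<in>A. of_int (a v e) * var (q v)) =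
    (\<Sum>v\<in>A. of_int (\<Sum>e\<in>incident_edges E w. a v e) * var (q v))"
  by (subst sum.swap) (simp add: sum_distrib_right)

text \<open>With linear forms on the edges, the \<open>k\<close>-th powers lie in the ideal
  automatically. What remains are conditions on the vertex sums of the weightings
  \<open>a v\<close>, which are the coefficients of the forms at the vertices.\<close>

lemma non_singular_edge_index_linear:
  fixes a :: "'a \<Rightarrow> 'a set \<Rightarrow> int" and q :: "'a \<Rightarrow> 'v::linorder"
  assumes "simple_graph V E" "orientation E D" "prime k"
    and lead: "\<And>w. w \<in> V \<Longrightarrow>
      leading (\<Sum>v\<in>A. of_int (\<Sum>e\<in>incident_edges E w. a v e) * var (q v)) (single (q w) 1) (c w)"
    and "\<And>w. w \<in> V \<Longrightarrow> \<not> int k dvd c w"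
    and "\<And>v w. {v, w} \<in> E \<Longrightarrow> q v \<noteq> q w"
    and "\<And>i. card {e \<in> E. Min (q ` e) = i} < k"
  shows "\<exists>\<eta>. non_singular V E D \<eta> \<and> (\<forall>v\<in>V. \<eta> (Inl v) = 0) \<and> (\<forall>e\<in>E. \<eta> (Inr e) \<le> k - 1)"
proof (rule non_singular_edge_index[OF assms(1-3)])
  let ?x = "\<lambda>e. \<Sum>v\<in>A. of_int (a v e) * var (q v)"
  show "subst (case_sum (\<lambda>_. 0) ?x) (graph_poly E D) \<notin> frobenius_ideal k"
    using assms(5-7) lead
    by (intro subst_graph_poly_notin_frobenius_ideal[OF assms(1-3), of ?x q c])
      (simp_all add: sum_incident_linear_forms)
  show "?x e ^ k \<in> frobenius_ideal k" for e
    using assms(3) by (rule frobenius_ideal_power_linear)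
qed


section \<open>Edge weightings and the incidence matrix\<close>

text \<open>Abstracts the weights 1, -1, 1, ... along a walk from \<open>u\<close> to
  \<open>v\<close>, which cancel at inner vertices: \<open>t\<close> is 1 for odd and -1 for even
  length. If \<open>u = v\<close>, both contributions add up.\<close>

definition walk_weighting :: "'a set set \<Rightarrow> 'a \<Rightarrow> 'a \<Rightarrow> int \<Rightarrow> ('a set \<Rightarrow> int) \<Rightarrow> bool" where
  "walk_weighting E u v t a \<longleftrightarrow>
    (\<forall>w. (\<Sum>e\<in>incident_edges E w. a e) = of_bool (w = u) + t * of_bool (w = v))"

lemma sum_incident_edges_single:
  assumes "finite E" "{y, z} \<in> E" "y \<noteq> z"
  shows "(\<Sum>e\<in>incident_edges E w. s * of_bool (e = {y, z})) = s * (of_bool (w = y) + of_bool (w = z) :: int)"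
proof -
  have "(\<Sum>e\<in>incident_edges E w. s * of_bool (e = {y, z})) =
      (\<Sum>e\<in>incident_edges E w. if e = {y, z} then s else 0)"
    by (intro sum.cong) auto
  also have "\<dots> = (if {y, z} \<in> incident_edges E w then s else 0)"
    using assms(1) by (subst sum.delta) (simp_all add: incident_edges_def)
  finally show ?thesis
    using assms(2,3) by (auto simp: incident_edges_def)
qed

text \<open>Appends an edge: its weight \<open>- t\<close> cancels the sum \<open>t\<close> at
  \<open>y\<close> and moves it, negated, to \<open>z\<close>.\<close>

lemma walk_weighting_step:
  assumes "finite E" "{y, z} \<in> E" "y \<noteq> z" "walk_weighting E u y t a"
  shows "walk_weighting E u z (- t) (\<lambda>e. a e - t * of_bool (e = {y, z}))"
  using assms unfolding walk_weighting_def
  by (simp add: sum_subtractf sum_incident_edges_single algebra_simps)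

text \<open>Prepends an edge of weight 1; negating the old weights makes the sums at
  \<open>y\<close> cancel.\<close>

lemma walk_weighting_step_start:
  assumes "finite E" "{y, z} \<in> E" "y \<noteq> z" "walk_weighting E y v t a"
  shows "walk_weighting E z v (- t) (\<lambda>e. of_bool (e = {y, z}) - a e)"
  using assms sum_incident_edges_single[OF assms(1-3), where s = 1] unfolding walk_weighting_def
  by (simp add: sum_subtractf algebra_simps)

lemma simple_graph_edge_neq: "simple_graph V E \<Longrightarrow> {y, z} \<in> E \<Longrightarrow> y \<noteq> z"
  using simple_graph.edge_ends[of V E "{y, z}"] by auto

lemma connected_walk_weighting:
  assumes "simple_graph V E" "connected_graph V E" "u \<in> V" "v \<in> V"
  shows "\<exists>t\<in>{1, - 1}. \<exists>a. walk_weighting E u v t a"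
proof -
  have "(u, v) \<in> {(x, y). {x, y} \<in> E}\<^sup>*"
    using assms by (auto simp: connected_graph_def)
  then show ?thesis
  proof (induction rule: rtrancl_induct)
    case base
    \<comment> \<open>The trivial walk has even length, so its two end contributions cancel.\<close>
    have "walk_weighting E u u (- 1) (\<lambda>_. 0)"
      by (simp add: walk_weighting_def)
    then show ?case by blast
  next
    case (step y z)
    then obtain t a where "t \<in> {1, - 1}" "walk_weighting E u y t a" by blast
    moreover have "{y, z} \<in> E" "y \<noteq> z"
      using step simple_graph_edge_neq[OF assms(1)] by auto
    ultimately have "walk_weighting E u z (- t) (\<lambda>e. a e - t * of_bool (e = {y, z}))"
      using simple_graph_finite_edges[OF assms(1)] by (intro walk_weighting_step)
    then show ?case
      using \<open>t \<in> {1, - 1}\<close> by auto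
  qed
qed

text \<open>Some \<open>u\<close> has weightings towards \<open>v\<close> of both signs, since
  otherwise the sign would define a bipartition. In the difference of the two, the sums at
  \<open>u\<close> cancel and those at \<open>v\<close> add up to 2.\<close>

lemma nonbipartite_weighting:
  assumes "simple_graph V E" "connected_graph V E" "\<not> bipartite V E" "v \<in> V"
  shows "\<exists>a :: 'a set \<Rightarrow> int. \<forall>w. (\<Sum>e\<in>incident_edges E w. a e) = 2 * of_bool (w = v)" (is "\<exists>a. ?double a")
proof -
  define X where "X t = {u \<in> V. \<exists>a. walk_weighting E u v t a}" for t
  have switch: "z \<in> X (- t)" if "{y, z} \<in> E" "y \<in> X t" for y z t
  proof -
    have "z \<in> V"
      using that(1) simple_graph.edge_ends[OF assms(1)] by blast
    moreover have "\<exists>a. walk_weighting E z v (- t) a"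
      using that walk_weighting_step_start[OF simple_graph_finite_edges[OF assms(1)]]
        simple_graph_edge_neq[OF assms(1)] by (fastforce simp: X_def)
    ultimately show ?thesis
      by (simp add: X_def)
  qed
  have cover: "X 1 \<union> X (- 1) = V"
    using connected_walk_weighting[OF assms(1,2) _ assms(4)] by (fastforce simp: X_def)
  have "X 1 \<inter> X (- 1) \<noteq> {}"
  proof
    assume "X 1 \<inter> X (- 1) = {}"
    moreover have "\<exists>x\<in>X 1. \<exists>y\<in>X (- 1). e = {x, y}" if e: "e \<in> E" for e
    proof -
      obtain y z where yz: "e = {y, z}"
        using simple_graph.edge_ends[OF assms(1) e] unfolding card_2_iff by blast
      then have "y \<in> X 1 \<union> X (- 1)"
        using simple_graph.edge_ends[OF assms(1) e] cover yz by auto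
      then show ?thesis
        using switch[of y z 1] switch[of y z "- 1"] e yz by auto
    qed
    ultimately have "bipartite V E"
      unfolding bipartite_def using cover by (intro exI[of _ "X 1"] exI[of _ "X (- 1)"]) simp
    then show False
      using assms(3) by simp
  qed
  then obtain u a b where "walk_weighting E u v 1 a" "walk_weighting E u v (- 1) b"
    by (auto simp: X_def)
  then have "?double (\<lambda>e. a e - b e)"
    by (simp add: walk_weighting_def sum_subtractf)
  then show ?thesis by blast
qed


section \<open>Degeneracy orders\<close>

text \<open>Induction on \<open>W\<close>: a vertex of degree at most \<open>d\<close> in the
  subgraph induced by \<open>W\<close> is put first, and the others follow in an order of the rest.
  Each vertex is then the least end of at most \<open>d\<close> edges inside
  \<open>W\<close>.\<close>

lemma degenerate_order:
  assumes "simple_graph V E" "degenerate d V E" "W \<subseteq> V"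
  shows "\<exists>p::'a \<Rightarrow> nat. inj_on p W \<and>
    (\<forall>v\<in>W. card {e \<in> E. e \<subseteq> W \<and> v \<in> e \<and> (\<forall>w\<in>e. p v \<le> p w)} \<le> d)"
  using finite_subset[OF assms(3) simple_graph.finite_vertices[OF assms(1)]] assms(3)
proof (induction W rule: finite_psubset_induct)
  case (psubset W)
  have finE: "finite E"
    by (rule simple_graph_finite_edges[OF assms(1)])
  show ?case
  proof (cases "W = {}")
    case False
    have "simple_graph W {e \<in> E. e \<subseteq> W}"
      using psubset.hyps simple_graph.edge_ends[OF assms(1)] by (auto simp: simple_graph_def)
    then obtain v where v: "v \<in> W" "graph_degree {e \<in> E. e \<subseteq> W} v \<le> d"
      using assms(2) psubset.prems False unfolding degenerate_def subgraph_of_def by blast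
    obtain p :: "'a \<Rightarrow> nat" where p: "inj_on p (W - {v})"
      "\<And>u. u \<in> W - {v} \<Longrightarrow>
        card {e \<in> E. e \<subseteq> W - {v} \<and> u \<in> e \<and> (\<forall>w\<in>e. p u \<le> p w)} \<le> d"
      using psubset.IH[of "W - {v}"] psubset.prems v(1) by blast
    define p' where "p' w = (if w = v then 0 else Suc (p w))" for w
    have "card {e \<in> E. e \<subseteq> W \<and> u \<in> e \<and> (\<forall>w\<in>e. p' u \<le> p' w)} \<le> d" if "u \<in> W" for u
    proof (cases "u = v")
      case True
      have "card {e \<in> E. e \<subseteq> W \<and> u \<in> e \<and> (\<forall>w\<in>e. p' u \<le> p' w)}
          \<le> graph_degree {e \<in> E. e \<subseteq> W} v"
        unfolding graph_degree_def incident_edges_def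
        using finE True by (intro card_mono) auto
      then show ?thesis using v(2) by simp
    next
      case False
      have "card {e \<in> E. e \<subseteq> W \<and> u \<in> e \<and> (\<forall>w\<in>e. p' u \<le> p' w)}
          \<le> card {e \<in> E. e \<subseteq> W - {v} \<and> u \<in> e \<and> (\<forall>w\<in>e. p u \<le> p w)}"
        using finE False by (intro card_mono) (auto simp: p'_def split: if_splits)
      then show ?thesis using p(2)[of u] False that by simp
    qed
    moreover have "inj_on p' W"
      using p(1) by (auto simp: inj_on_def p'_def)
    ultimately show ?thesis by blast
  qed simp
qed

text \<open>All of \<open>U\<close> is put in front with the common value 0, followed by a
  degeneracy order of \<open>V - U\<close>. Edges with minimum 0 are those meeting \<open>U\<close>;
  a positive minimum is attained by at most \<open>d\<close> edges.\<close>

lemma degenerate_order_from: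
  assumes "simple_graph V E" "degenerate d V E" "d < k" "card {e \<in> E. e \<inter> U \<noteq> {}} < k"
  obtains q :: "'a \<Rightarrow> nat" where "inj_on q (V - U)" "\<And>w. q w = 0 \<longleftrightarrow> w \<in> U"
    "\<And>i. card {e \<in> E. Min (q ` e) = i} < k"
proof -
  obtain p :: "'a \<Rightarrow> nat" where p: "inj_on p (V - U)"
    "\<And>v. v \<in> V - U \<Longrightarrow> card {e \<in> E. e \<subseteq> V - U \<and> v \<in> e \<and> (\<forall>w\<in>e. p v \<le> p w)} \<le> d"
    using degenerate_order[OF assms(1,2), of "V - U"] by blast
  define q where "q w = (if w \<in> U then 0 else Suc (p w))" for w
  have finE: "finite E"
    by (rule simple_graph_finite_edges[OF assms(1)])
  have E: "finite e" "e \<noteq> {}" "e \<subseteq> V" if "e \<in> E" for e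
    using simple_graph.edge_ends[OF assms(1) that] by (auto intro: card_ge_0_finite)
  have "card {e \<in> E. Min (q ` e) = i} < k" for i
  proof (cases "\<exists>e0\<in>E. Min (q ` e0) = i \<and> i \<noteq> 0")
    case False
    then have "{e \<in> E. Min (q ` e) = i} \<subseteq> {e \<in> E. e \<inter> U \<noteq> {}}"
    proof (intro subsetI CollectI conjI notI)
      fix e assume "e \<in> {e \<in> E. Min (q ` e) = i}" and U: "e \<inter> U = {}"
      then have e: "e \<in> E" "Min (q ` e) = i" by simp_all
      then have "i \<in> q ` e"
        using E Min_in[of "q ` e"] by auto
      then have "i \<noteq> 0"
        using U by (auto simp: q_def split: if_splits)
      then show False
        using False e by blast
    qed simp
    then have "card {e \<in> E. Min (q ` e) = i} \<le> card {e \<in> E. e \<inter> U \<noteq> {}}"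
      using finE by (intro card_mono) auto
    then show ?thesis using assms(4) by simp
  next
    case True
    then obtain e0 where e0: "e0 \<in> E" "Min (q ` e0) = i" "i \<noteq> 0" by blast
    then have "i \<in> q ` e0"
      using E Min_in[of "q ` e0"] by auto
    then obtain v where v: "v \<in> V - U" "i = Suc (p v)"
      using E(3)[OF e0(1)] e0(3) by (auto simp: q_def split: if_splits)
    have "e \<subseteq> V - U \<and> v \<in> e \<and> (\<forall>w\<in>e. p v \<le> p w)" if e: "e \<in> E" "Min (q ` e) = i" for e
    proof -
      have le: "Suc (p v) \<le> q w" if "w \<in> e" for w
        using Min_le[of "q ` e" "q w"] E(1)[OF e(1)] that e(2) v(2) by simp
      then have sub: "e \<subseteq> V - U"
        using E(3)[OF e(1)] by (fastforce simp: q_def)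
      have "Min (q ` e) \<in> q ` e"
        using E[OF e(1)] by (intro Min_in) auto
      then obtain w where "w \<in> e" "q w = Suc (p v)"
        using e(2) v(2) by auto
      then have "w = v"
        using sub v(1) inj_onD[OF p(1)] by (auto simp: q_def split: if_splits)
      then show ?thesis
        using le sub \<open>w \<in> e\<close> by (fastforce simp: q_def)
    qed
    then have "card {e \<in> E. Min (q ` e) = i}
        \<le> card {e \<in> E. e \<subseteq> V - U \<and> v \<in> e \<and> (\<forall>w\<in>e. p v \<le> p w)}"
      using finE by (intro card_mono) auto
    then show ?thesis
      using p(2)[OF v(1)] assms(3) by simp
  qed
  moreover have "inj_on q (V - U)"
    using p(1) by (auto simp: inj_on_def q_def)
  moreover have "q w = 0 \<longleftrightarrow> w \<in> U" for w
    by (simp add: q_def)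
  ultimately show ?thesis
    using that by blast
qed

section \<open>The non-bipartite and the bipartite case\<close>

theorem theorem2:
  fixes V :: "'a set" and E :: "'a set set" and D :: "('a \<times> 'a) set" and d k :: nat
  assumes "simple_graph V E"
    and "orientation E D"
    and "connected_graph V E"
    and "degenerate d V E"
    and "prime k" and "k > d" and "d \<ge> 2"
    and "\<not> bipartite V E \<or>
      (bipartite V E \<and>
        (\<exists>u\<in>V. \<exists>v\<in>V. u \<noteq> v \<and> {u, v} \<notin> E \<and> graph_degree E u + graph_degree E v < k))"
  shows "\<exists>\<eta>. non_singular V E D \<eta> \<and> (\<forall>v\<in>V. \<eta> (Inl v) = 0) \<and> (\<forall>e\<in>E. \<eta> (Inr e) \<le> k - 1)"
proof -
  have finV: "finite V"
    by (rule simple_graph.finite_vertices[OF assms(1)])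
  have edge: "v \<in> V" "w \<in> V" "v \<noteq> w" if "{v, w} \<in> E" for v w
    using simple_graph.edge_ends[OF assms(1) that] simple_graph_edge_neq[OF assms(1) that] by auto
  from assms(8) show ?thesis
  proof (elim disjE conjE bexE)
    assume "\<not> bipartite V E"
    then have "\<forall>v\<in>V. \<exists>a. \<forall>w. (\<Sum>e\<in>incident_edges E w. a e) = (2 * of_bool (w = v) :: int)"
      using nonbipartite_weighting[OF assms(1,3)] by blast
    then obtain a :: "'a \<Rightarrow> 'a set \<Rightarrow> int" where
      a: "\<And>v w. v \<in> V \<Longrightarrow> (\<Sum>e\<in>incident_edges E w. a v e) = 2 * of_bool (w = v)"
      by metis
    obtain q :: "'a \<Rightarrow> nat" where q: "inj_on q V" "\<And>i. card {e \<in> E. Min (q ` e) = i} < k"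
      by (rule degenerate_order_from[OF assms(1,4,6), of "{}"]) (use assms(6) in auto)
    show ?thesis
    \<comment> \<open>The form at \<open>w\<close> is twice its own variable, so any injective
      \<open>q\<close> gives the leading terms.\<close>
    proof (rule non_singular_edge_index_linear[OF assms(1,2,5), where A = V and a = a and q = q and c = "\<lambda>_. 2"])
      fix w assume w: "w \<in> V"
      show "leading (\<Sum>v\<in>V. of_int (\<Sum>e\<in>incident_edges E w. a v e) * var (q v)) (single (q w) 1) 2"
        using leading_linear[OF finV w, of "\<lambda>v. \<Sum>e\<in>incident_edges E w. a v e" q] a w
        by (auto split: if_splits)
      show "\<not> int k dvd 2"
        using assms(6,7) zdvd_imp_le[of "int k" 2] by auto
    next
      fix v w assume "{v, w} \<in> E"
      then show "q v \<noteq> q w"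
        using edge inj_onD[OF q(1)] by blast
    qed (rule q(2))
  next
    fix u v assume u: "u \<in> V" and v: "v \<in> V" and uv: "u \<noteq> v" "{u, v} \<notin> E"
      and deg: "graph_degree E u + graph_degree E v < k"
    \<comment> \<open>All weightings end in \<open>u\<close>, so every unwanted contribution is
      collected there.\<close>
    have "\<forall>w\<in>V. \<exists>t a. t \<in> {1, - 1} \<and> walk_weighting E w u t a"
      using connected_walk_weighting[OF assms(1,3) _ u] by blast
    then obtain t a where t: "\<And>w. w \<in> V \<Longrightarrow> t w \<in> {1, - 1}"
      and "\<And>w. w \<in> V \<Longrightarrow> walk_weighting E w u (t w) (a w)"
      by metis
    then have a: "(\<Sum>e\<in>incident_edges E w. a j e) = of_bool (w = j) + t j * of_bool (w = u)"
      if "j \<in> V" for j w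
      using that by (simp add: walk_weighting_def)
    have "{e \<in> E. e \<inter> {u, v} \<noteq> {}} = incident_edges E u \<union> incident_edges E v"
      by (auto simp: incident_edges_def)
    then have "card {e \<in> E. e \<inter> {u, v} \<noteq> {}} < k"
      using deg card_Un_le[of "incident_edges E u" "incident_edges E v"]
      by (simp add: graph_degree_def)
    then obtain q :: "'a \<Rightarrow> nat" where q: "inj_on q (V - {u, v})" "\<And>w. q w = 0 \<longleftrightarrow> w \<in> {u, v}"
      "\<And>i. card {e \<in> E. Min (q ` e) = i} < k"
      using degenerate_order_from[OF assms(1,4,6), of "{u, v}"] by blast
    show ?thesis
    \<comment> \<open>The vertex \<open>u\<close> gets no variable of its own. Its form is the sum
      of all \<open>t j\<close> times the variable of \<open>j\<close>, led by that of
      \<open>v\<close>, the only one with value 0.\<close>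
    proof (rule non_singular_edge_index_linear[OF assms(1,2,5), where A = "V - {u}" and a = a and q = q
        and c = "\<lambda>w. if w = u then t v else 1"])
      fix w assume w: "w \<in> V"
      let ?i = "if w = u then v else w"
      let ?c = "\<lambda>j. \<Sum>e\<in>incident_edges E w. a j e"
      have "leading (\<Sum>j\<in>V - {u}. of_int (?c j) * var (q j)) (single (q ?i) 1) (?c ?i)"
      proof (rule leading_linear)
        fix j assume j: "j \<in> V - {u}" "j \<noteq> ?i" "?c j \<noteq> 0"
        then have "w = u"
          using a[of j w] by (auto split: if_splits)
        then show "q ?i < q j"
          using j q(2)[of v] q(2)[of j] by auto
      qed (use finV u v uv w in auto)
      \<comment> \<open>The shared value 0 of \<open>u\<close> and \<open>v\<close> lets the leading
        variable at \<open>u\<close> be written as that of \<open>q u\<close>.\<close>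
      moreover have "q ?i = q w"
        using q(2)[of u] q(2)[of v] by simp
      moreover have "?c ?i = (if w = u then t v else 1)"
        using a[of ?i w] u v w uv by auto
      ultimately show "leading (\<Sum>j\<in>V - {u}. of_int (?c j) * var (q j)) (single (q w) 1)
          (if w = u then t v else 1)"
        by simp
      show "\<not> int k dvd (if w = u then t v else 1)"
        using t[OF v] prime_gt_1_nat[OF assms(5)] by auto
    next
      fix x y assume xy: "{x, y} \<in> E"
      \<comment> \<open>Non-adjacency enters here: the only repeated value of \<open>q\<close> on
        \<open>V\<close> is at \<open>u\<close> and \<open>v\<close>, which no edge joins.\<close>
      then have "\<not> (x \<in> {u, v} \<and> y \<in> {u, v})"
        using edge(3)[OF xy] uv(2) by (auto simp: insert_commute)
      then show "q x \<noteq> q y"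
        using q(2)[of x] q(2)[of y] inj_onD[OF q(1), of x y] edge[OF xy] by auto
    qed (rule q(3))
  qed
qed

end
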